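(* Let $(A,W)$ be a concise representation of a game in characteristic form without transferable utility, with utility possibility sets $V(B)$, and let $u^A=(u^A_a)_{a\in A}\in V(A)$ be an outcome. Then $u^A$ is blocked by some coalition if and only if it is blocked by some coalition $B$ through some utility vector $u^B$ with $(B,u^B)\in W$, i.e. if and only if there is $(B,u^B)\in W$ such that $u^B_b>u^A_b$ for all $b\in B$.
   Context: A coalition is a nonempty subset of the finite player set $A$. A concise representation of a game in characteristic form without transferable utility consists of $A$ and a finite set $W$ of pairs $(B, u^{B})$, where $B$ is a coalition and $u^{B} = (u^{B}_b)_{b\in B}$ is a vector of utilities indexed by the members of $B$ (there may be several pairs with the same $B$). It is required that $(\{a\},(0)) \in W$ for every $a\in A$. The utility possibility set of a coalition $B$ is $$V(B) = \{ (u^{B_1},\ldots,u^{B_r}) : r\ge 1,\ B_1,\ldots,B_r \text{ pairwise disjoint coalitions},\ \textstyle\bigcup_{i} B_i = B,\ (B_i,u^{B_i})\in W \text{ for all } i\},$$ where $(u^{B_1},\ldots,u^{B_r})$ denotes the vector indexed by $B$ obtained by concatenation. An outcome is an element $u^A\in V(A)$. It is blocked by a coalition $B\subseteq A$ (through $u^B$) if there is $u^B\in V(B)$ with $u^B_b > u^A_b$ for all $b\in B$. *)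

theory Defs
  imports Complex_Main "HOL-Library.FuncSet" "HOL-Library.Disjoint_Sets"
begin

definition coalition :: "'a set \<Rightarrow> 'a set \<Rightarrow> bool" where
  "coalition A B \<longleftrightarrow> B \<subseteq> A \<and> B \<noteq> {}"

text \<open>A utility vector indexed by \<open>B\<close> is a function in \<open>B \<rightarrow>\<^sub>E UNIV\<close>, i.e. it is \<open>undefined\<close>
  outside \<open>B\<close>, so that equality of such functions is equality of vectors.\<close>

definition concise_representation :: "'a set \<Rightarrow> ('a set \<times> ('a \<Rightarrow> real)) set \<Rightarrow> bool" where
  "concise_representation A W \<longleftrightarrow>
     finite A \<and> finite W \<and>
     (\<forall>(B, u) \<in> W. coalition A B \<and> u \<in> B \<rightarrow>\<^sub>E UNIV) \<and>
     (\<forall>a \<in> A. ({a}, \<lambda>b\<in>{a}. 0) \<in> W)"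

text \<open>The vector \<open>u\<close> indexed by \<open>B\<close> is the concatenation of the \<open>us i\<close> when its restriction
  to each block \<open>Bs i\<close> of the partition is \<open>us i\<close>.\<close>

definition utility_possibility_set ::
    "'a set \<Rightarrow> ('a set \<times> ('a \<Rightarrow> real)) set \<Rightarrow> 'a set \<Rightarrow> ('a \<Rightarrow> real) set" where
  "utility_possibility_set A W B =
     {u \<in> B \<rightarrow>\<^sub>E UNIV.
        \<exists>(r::nat) Bs us.
          1 \<le> r \<and> (\<forall>i \<in> {1..r}. coalition A (Bs i)) \<and>
          disjoint_family_on Bs {1..r} \<and> (\<Union>i \<in> {1..r}. Bs i) = B \<and>
          (\<forall>i \<in> {1..r}. (Bs i, us i) \<in> W \<and> restrict u (Bs i) = us i)}"

definition blocked_through ::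
    "'a set \<Rightarrow> ('a set \<times> ('a \<Rightarrow> real)) set \<Rightarrow> ('a \<Rightarrow> real) \<Rightarrow> 'a set \<Rightarrow> ('a \<Rightarrow> real) \<Rightarrow> bool" where
  "blocked_through A W uA B uB \<longleftrightarrow>
     coalition A B \<and> uB \<in> utility_possibility_set A W B \<and> (\<forall>b \<in> B. uB b > uA b)"

definition blocked_by ::
    "'a set \<Rightarrow> ('a set \<times> ('a \<Rightarrow> real)) set \<Rightarrow> ('a \<Rightarrow> real) \<Rightarrow> 'a set \<Rightarrow> bool" where
  "blocked_by A W uA B \<longleftrightarrow> (\<exists>uB. blocked_through A W uA B uB)"

end

theory Submission imports Defs begin

text \<open>A vector of \<open>V(B)\<close> is glued from vectors of \<open>W\<close> along a
  partition of \<open>B\<close>. If it beats \<open>uA\<close> on all of \<open>B\<close>, it does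
  so on each block, so any one block with its own vector is already a blocking pair in
  \<open>W\<close> (\<open>utility_possibility_set_block\<close>). Conversely, a pair in
  \<open>W\<close> is a one-block gluing, so its vector is feasible for its coalition
  (\<open>mem_utility_possibility_set\<close>).\<close>

lemma mem_utility_possibility_set:
  assumes "concise_representation A W" and "(B, u) \<in> W"
  shows "u \<in> utility_possibility_set A W B"
proof -
  have B: "coalition A B" and u: "u \<in> B \<rightarrow>\<^sub>E UNIV"
    using assms unfolding concise_representation_def by auto
  \<comment> \<open>The gluing condition for the partition with the single block \<open>B\<close>;
    it holds because \<open>u\<close> is \<open>undefined\<close> outside \<open>B\<close>.\<close>
  have "restrict u B = u"
    using u by (rule PiE_restrict)
  then have "\<exists>(r::nat) Bs us. 1 \<le> r \<and> (\<forall>i \<in> {1..r}. coalition A (Bs i)) \<and>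
          disjoint_family_on Bs {1..r} \<and> (\<Union>i \<in> {1..r}. Bs i) = B \<and>
          (\<forall>i \<in> {1..r}. (Bs i, us i) \<in> W \<and> restrict u (Bs i) = us i)"
    using B assms(2)
    by (intro exI[of _ 1] exI[of _ "\<lambda>_. B"] exI[of _ "\<lambda>_. u"]) (auto simp: disjoint_family_on_def)
  with u show ?thesis
    unfolding utility_possibility_set_def by blast
qed

text \<open>Since \<open>1 \<le> r\<close>, the partition has a block with index 1, and gluing
  forces its vector to be the restriction of \<open>u\<close>.\<close>

lemma utility_possibility_set_block:
  assumes "u \<in> utility_possibility_set A W B"
  obtains C where "C \<subseteq> B" and "(C, restrict u C) \<in> W"
proof -
  from assms obtain r :: nat and Bs us where "1 \<le> r" "(\<Union>i \<in> {1..r}. Bs i) = B"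
    "\<forall>i \<in> {1..r}. (Bs i, us i) \<in> W \<and> restrict u (Bs i) = us i"
    unfolding utility_possibility_set_def by blast
  then have "Bs 1 \<subseteq> B" "(Bs 1, restrict u (Bs 1)) \<in> W"
    by auto
  then show thesis
    by (rule that)
qed

theorem lemma1:
  fixes A :: "'a set" and W :: "('a set \<times> ('a \<Rightarrow> real)) set" and uA :: "'a \<Rightarrow> real"
  assumes "concise_representation A W"
    and "uA \<in> utility_possibility_set A W A"
  shows "((\<exists>B. blocked_by A W uA B) \<longleftrightarrow>
           (\<exists>B uB. (B, uB) \<in> W \<and> blocked_through A W uA B uB)) \<and>
         ((\<exists>B. blocked_by A W uA B) \<longleftrightarrow>
           (\<exists>(B, uB) \<in> W. \<forall>b \<in> B. uB b > uA b))"
proof -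
  have block: "\<exists>(C, uC) \<in> W. \<forall>b \<in> C. uC b > uA b" if "blocked_by A W uA B" for B
  proof -
    from that obtain u where u: "u \<in> utility_possibility_set A W B" "\<forall>b \<in> B. u b > uA b"
      unfolding blocked_by_def blocked_through_def by blast
    from u(1) obtain C where "C \<subseteq> B" "(C, restrict u C) \<in> W"
      by (rule utility_possibility_set_block)
    with u(2) show ?thesis
      by (intro bexI[of _ "(C, restrict u C)"]) auto
  qed
  have through: "blocked_through A W uA B uB" if "(B, uB) \<in> W" "\<forall>b \<in> B. uB b > uA b" for B uB
    using that assms(1) mem_utility_possibility_set[OF assms(1) that(1)]
    unfolding blocked_through_def concise_representation_def by auto
  \<comment> \<open>The three conditions form a cycle: \<open>block\<close> yields a dominating pair
    in \<open>W\<close>, \<open>through\<close> makes it a blocking one, and that is a case of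
    blocking.\<close>
  show ?thesis
    using block through unfolding blocked_by_def by blast
qed

end
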